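(* Let $\lambda>\aleph_0$ be a regular cardinal. Then there is a uniform weakly reasonable ultrafilter $D$ on $\lambda$.
   Context: A uniform ultrafilter on $\lambda$ is an ultrafilter all of whose members have cardinality $\lambda$. $\mathcal{F}_\lambda$ denotes the family of all non-decreasing unbounded functions from $\lambda$ to $\lambda$. A uniform ultrafilter $D$ on $\lambda$ is weakly reasonable if for every $f\in\mathcal{F}_\lambda$ there is a club $C$ of $\lambda$ such that $\bigcup\{[\delta,\delta+f(\delta)):\delta\in C\}\notin D$. *)

theory Defs
  imports Main "HOL-Library.FuncSet"
begin

unbundle cardinal_syntax

text \<open>
  A cardinal \<open>\<lambda>\<close> is represented, as in the library, by a relation \<open>r\<close> with
  \<^term>\<open>Card_order r\<close>, that is, a well-order of minimal order type on its field.
  The ordinals below \<open>\<lambda>\<close> are the elements of \<^term>\<open>Field r\<close>, and \<^term>\<open>(x, y) \<in> r\<close>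
  means \<open>x \<le> y\<close>.
\<close>

section \<open>Ordinal addition below a cardinal\<close>

text \<open>
  Transfinite recursion on the right argument: \<open>a + b\<close> is the least \<open>x \<ge> a\<close> lying strictly
  above \<open>a + c\<close> for all \<open>c < b\<close>, which merges the zero, successor and limit clauses.  Such an
  \<open>x\<close> exists in \<^term>\<open>Field r\<close> when \<open>r\<close> is an infinite cardinal.
\<close>

definition ord_plus :: "'a rel \<Rightarrow> 'a \<Rightarrow> 'a \<Rightarrow> 'a" where
  "ord_plus r a = wo_rel.worec r
     (\<lambda>g b. wo_rel.minim r
        {x \<in> Field r. (a, x) \<in> r \<and> (\<forall>c \<in> underS r b. (g c, x) \<in> r \<and> g c \<noteq> x)})"

lemma ord_plus_unfold:
  assumes "Well_order r"
  shows "ord_plus r a b = wo_rel.minim r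
    {x \<in> Field r. (a, x) \<in> r \<and>
       (\<forall>c \<in> underS r b. (ord_plus r a c, x) \<in> r \<and> ord_plus r a c \<noteq> x)}"
proof -
  interpret wo_rel r using assms by (simp add: wo_rel_def)
  let ?H = "\<lambda>g b. minim
    {x \<in> Field r. (a, x) \<in> r \<and> (\<forall>c \<in> underS b. (g c, x) \<in> r \<and> g c \<noteq> x)}"
  have "adm_wo ?H"
    unfolding adm_wo_def by (intro allI impI arg_cong[where f = minim]) auto
  from worec_fixpoint[OF this] show ?thesis
    unfolding ord_plus_def by (rule fun_cong)
qed

definition ord_interval :: "'a rel \<Rightarrow> 'a \<Rightarrow> 'a \<Rightarrow> 'a set" where
  "ord_interval r a b = {x \<in> underS r b. (a, x) \<in> r}"


section \<open>Clubs and non-decreasing unbounded functions\<close>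

text \<open>
  \<^const>\<open>cofinal\<close> is strict: every element of the order has a strictly larger element of the set.
  Below a limit ordinal this is unboundedness.  If \<open>C\<close> is cofinal in the set of predecessors
  of \<open>d\<close>, then \<open>d\<close> is zero or a limit; zero is excluded explicitly.
\<close>

definition closed_in_order :: "'a rel \<Rightarrow> 'a set \<Rightarrow> bool" where
  "closed_in_order r C \<longleftrightarrow>
     (\<forall>d \<in> Field r. underS r d \<noteq> {} \<and> cofinal (C \<inter> underS r d) (Restr r (underS r d))
        \<longrightarrow> d \<in> C)"

definition club :: "'a rel \<Rightarrow> 'a set \<Rightarrow> bool" where
  "club r C \<longleftrightarrow> C \<subseteq> Field r \<and> cofinal C r \<and> closed_in_order r C"

text \<open>Only the values on \<^term>\<open>Field r\<close> matter.\<close>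

definition nondecreasing_unbounded :: "'a rel \<Rightarrow> ('a \<Rightarrow> 'a) set" where
  "nondecreasing_unbounded r =
     {f \<in> Field r \<rightarrow> Field r.
        monotone_on (Field r) (\<lambda>x y. (x, y) \<in> r) (\<lambda>x y. (x, y) \<in> r) f \<and>
        cofinal (f ` Field r) r}"


section \<open>Uniform and weakly reasonable ultrafilters\<close>

definition ultrafilter_on :: "'a set \<Rightarrow> 'a set set \<Rightarrow> bool" where
  "ultrafilter_on X D \<longleftrightarrow>
     D \<subseteq> Pow X \<and> X \<in> D \<and> {} \<notin> D \<and>
     (\<forall>A \<in> D. \<forall>B \<in> D. A \<inter> B \<in> D) \<and>
     (\<forall>A \<in> D. \<forall>B. A \<subseteq> B \<and> B \<subseteq> X \<longrightarrow> B \<in> D) \<and>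
     (\<forall>A. A \<subseteq> X \<longrightarrow> A \<in> D \<or> X - A \<in> D)"

definition uniform_ultrafilter :: "'a rel \<Rightarrow> 'a set set \<Rightarrow> bool" where
  "uniform_ultrafilter r D \<longleftrightarrow> ultrafilter_on (Field r) D \<and> (\<forall>A \<in> D. |A| =o r)"

definition weakly_reasonable :: "'a rel \<Rightarrow> 'a set set \<Rightarrow> bool" where
  "weakly_reasonable r D \<longleftrightarrow>
     uniform_ultrafilter r D \<and>
     (\<forall>f \<in> nondecreasing_unbounded r. \<exists>C. club r C \<and>
        (\<Union>d \<in> C. ord_interval r d (ord_plus r d (f d))) \<notin> D)"

end

theory Submission
  imports Defs "HOL-Algebra.Free_Abelian_Groups"
begin

text \<open>
  The interval $[\delta, \delta + f(\delta))$ is replaced by $[\delta, p(\delta))$ for an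
  arbitrary \<open>p\<close>.  Enlarging \<open>p\<close> on a tail only makes the task harder, so it suffices to choose
  clubs \<open>C\<^sub>p\<close> for the members \<open>p\<close> of a family \<open>K\<close> that dominates all functions on $\lambda$ modulo
  bounded sets, in such a way that every finitely many of the sets
  $\lambda - \bigcup_{\delta \in C_p} [\delta, p(\delta))$ have unbounded intersection;
  an ultrafilter of unbounded sets extending these is then as desired.

  Let \<open>K\<close> have the least possible cardinality and choose the clubs by recursion along a
  well-order of \<open>K\<close> of type $|K|$.  At each stage fewer than $|K|$ unbounded sets \<open>A\<close> (the finite
  intersections so far) must remain unbounded.  For each of them let $g_A(x)$ be a point of \<open>A\<close>
  above \<open>x\<close> and above $p(d)$ for all $d \le x$.  By minimality some \<open>h\<close> is eventually dominated
  by no $g_A$.  Take the club of points closed under \<open>h\<close>: if $x < g_A(x) < h(x)$, then every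
  such point $d \le g_A(x)$ satisfies $d \le x$, hence $p(d) < g_A(x)$, so $g_A(x)$ is not
  covered.
\<close>

section \<open>Ultrafilters of big sets, and counting finite subsets\<close>

text \<open>Zorn's lemma gives a maximal family \<open>M\<close> with all finite intersections big.
  If neither \<open>A\<close> nor \<open>X - A\<close> could be added, the two witnessing finite
  families would together have a big intersection covered by two sets that are not big. The factor
  \<open>X\<close> is there because \<open>\<Inter>{}\<close> is \<open>UNIV\<close>.\<close>

lemma ultrafilter_extension:
  assumes mono: "\<And>A B. big A \<Longrightarrow> A \<subseteq> B \<Longrightarrow> B \<subseteq> X \<Longrightarrow> big B"
    and Un: "\<And>A B. big (A \<union> B) \<Longrightarrow> big A \<or> big B"
    and empty: "\<not> big {}"
    and sub: "\<B> \<subseteq> Pow X"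
    and fip: "\<And>S. finite S \<Longrightarrow> S \<subseteq> \<B> \<Longrightarrow> big (X \<inter> \<Inter>S)"
  shows "\<exists>D. ultrafilter_on X D \<and> \<B> \<subseteq> D \<and> (\<forall>A\<in>D. big A)"
proof -
  define \<A> where
    "\<A> = {M. \<B> \<subseteq> M \<and> M \<subseteq> Pow X \<and> (\<forall>S. finite S \<and> S \<subseteq> M \<longrightarrow> big (X \<inter> \<Inter>S))}"
  have "\<exists>M\<in>\<A>. \<forall>N\<in>\<A>. M \<subseteq> N \<longrightarrow> N = M"
  proof (rule subset_Zorn_nonempty)
    have "\<B> \<in> \<A>" using sub fip by (simp add: \<A>_def)
    then show "\<A> \<noteq> {}" by blast
    fix \<C> assume ne: "\<C> \<noteq> {}" and ch: "subset.chain \<A> \<C>"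
    have "\<C> \<subseteq> \<A>" using ch by (simp add: subset_chain_def)
    have "big (X \<inter> \<Inter>S)" if S: "finite S" "S \<subseteq> \<Union>\<C>" for S
    proof -
      obtain M where "M \<in> \<C>" "S \<subseteq> M" using finite_subset_Union_chain[OF S ne ch] .
      with \<open>\<C> \<subseteq> \<A>\<close> \<open>finite S\<close> show ?thesis by (auto simp: \<A>_def)
    qed
    moreover have "\<B> \<subseteq> \<Union>\<C>" "\<Union>\<C> \<subseteq> Pow X"
      using \<open>\<C> \<subseteq> \<A>\<close> ne unfolding \<A>_def by blast+
    ultimately show "\<Union>\<C> \<in> \<A>" by (simp add: \<A>_def)
  qed
  then obtain M where M: "M \<in> \<A>" and max: "\<And>N. N \<in> \<A> \<Longrightarrow> M \<subseteq> N \<Longrightarrow> N = M" by blast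
  have MX: "M \<subseteq> Pow X" and BM: "\<B> \<subseteq> M"
    and Mfip: "\<And>S. finite S \<Longrightarrow> S \<subseteq> M \<Longrightarrow> big (X \<inter> \<Inter>S)"
    using M by (auto simp: \<A>_def)
  \<comment> \<open>Maximality as a membership test; every clause below that puts a set into
    \<open>M\<close> goes through it.\<close>
  have add: "A \<in> M" if "A \<subseteq> X" and ext: "\<And>S. finite S \<Longrightarrow> S \<subseteq> M \<Longrightarrow> big (X \<inter> \<Inter>S \<inter> A)" for A
  proof -
    have "big (X \<inter> \<Inter>S)" if S: "finite S" "S \<subseteq> insert A M" for S
    proof -
      have "big (X \<inter> \<Inter>(S - {A}) \<inter> A)" using S by (intro ext) auto
      then show ?thesis by (rule mono) auto
    qed
    then have "insert A M \<in> \<A>" using \<open>A \<subseteq> X\<close> MX BM by (auto simp: \<A>_def)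
    with max show ?thesis by blast
  qed
  have big: "big A" if "A \<in> M" for A
    using Mfip[of "{A}"] mono[of "X \<inter> A" A] that MX by auto
  have "ultrafilter_on X M"
    unfolding ultrafilter_on_def
  proof (intro conjI ballI allI impI)
    show "X \<in> M" by (rule add) (auto intro: mono[OF Mfip])
    show "{} \<notin> M" using big empty by blast
    show "A \<inter> B \<in> M" if "A \<in> M" "B \<in> M" for A B
    proof (rule add)
      show "A \<inter> B \<subseteq> X" using that MX by auto
      show "big (X \<inter> \<Inter>S \<inter> (A \<inter> B))" if "finite S" "S \<subseteq> M" for S
        using Mfip[of "insert A (insert B S)"] that \<open>A \<in> M\<close> \<open>B \<in> M\<close>
        by (auto intro: mono)
    qed
    show "B \<in> M" if "A \<in> M" "A \<subseteq> B \<and> B \<subseteq> X" for A B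
    proof (rule add)
      show "B \<subseteq> X" using that by simp
      show "big (X \<inter> \<Inter>S \<inter> B)" if "finite S" "S \<subseteq> M" for S
        using Mfip[of "insert A S"] that \<open>A \<in> M\<close> \<open>A \<subseteq> B \<and> B \<subseteq> X\<close>
        by (auto intro: mono)
    qed
    show "A \<in> M \<or> X - A \<in> M" if "A \<subseteq> X" for A
    proof (rule ccontr)
      assume "\<not> (A \<in> M \<or> X - A \<in> M)"
      then obtain S T where S: "finite S" "S \<subseteq> M" "\<not> big (X \<inter> \<Inter>S \<inter> A)"
        and T: "finite T" "T \<subseteq> M" "\<not> big (X \<inter> \<Inter>T \<inter> (X - A))"
        using add[of A] add[of "X - A"] \<open>A \<subseteq> X\<close> by blast
      have "big (X \<inter> \<Inter>(S \<union> T))" using S T by (intro Mfip) auto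
      then have "big ((X \<inter> \<Inter>S \<inter> A) \<union> (X \<inter> \<Inter>T \<inter> (X - A)))"
        by (rule mono) auto
      with Un S T show False by blast
    qed
  qed (rule MX)
  with BM big show ?thesis by blast
qed

text \<open>An infinite set has as many finite subsets as elements. This bounds the number of finite
  intersections met at a stage of the recursion.\<close>

lemma card_of_Fpow_ordLess:
  assumes "|A| <o |B|" and "infinite B"
  shows "|Fpow A| <o |B|"
proof (cases "finite A")
  case True
  then have "finite (Fpow A)" by (simp add: Fpow_def)
  then show ?thesis using assms(2) by (rule finite_ordLess_infinite2)
next
  case False
  then show ?thesis
    using eqpoll_Fpow[OF False] assms(1) ordIso_ordLess_trans
    unfolding eqpoll_iff_card_of_ordIso by blast
qed

section \<open>Bounded sets in a regular uncountable cardinal\<close>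

locale regular_uncountable =
  fixes r :: "'a rel"
  assumes Card_order: "Card_order r" and regular: "regularCard r" and uncountable: "natLeq <o r"
begin

abbreviation le (infix "\<le>\<^sub>r" 50) where "x \<le>\<^sub>r y \<equiv> (x, y) \<in> r"
abbreviation less (infix "<\<^sub>r" 50) where "x <\<^sub>r y \<equiv> x \<noteq> y \<and> (x, y) \<in> r"

lemma wo_rel: "wo_rel r"
  using Card_order unfolding card_order_on_def wo_rel_def by blast

lemma refl: "x \<in> Field r \<Longrightarrow> x \<le>\<^sub>r x"
  using wo_rel.REFL[OF wo_rel] by (simp add: refl_on_def)

lemma trans: "x \<le>\<^sub>r y \<Longrightarrow> y \<le>\<^sub>r z \<Longrightarrow> x \<le>\<^sub>r z"
  using wo_rel.TRANS[OF wo_rel] by (rule transD)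

lemma antisym: "x \<le>\<^sub>r y \<Longrightarrow> y \<le>\<^sub>r x \<Longrightarrow> x = y"
  using wo_rel.ANTISYM[OF wo_rel] by (rule antisymD)

lemma total: "x \<in> Field r \<Longrightarrow> y \<in> Field r \<Longrightarrow> x \<le>\<^sub>r y \<or> y <\<^sub>r x"
  using wo_rel.in_notinI[OF wo_rel, of x y] by blast

lemma le_less_trans: "x \<le>\<^sub>r y \<Longrightarrow> y <\<^sub>r z \<Longrightarrow> x <\<^sub>r z"
  using trans[of x y z] antisym[of x y] by auto

lemma less_le_trans: "x <\<^sub>r y \<Longrightarrow> y \<le>\<^sub>r z \<Longrightarrow> x <\<^sub>r z"
  using trans[of x y z] antisym[of x y] by auto

lemma less_not_le: "x <\<^sub>r y \<Longrightarrow> \<not> y \<le>\<^sub>r x"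
  using antisym[of x y] by auto

lemma ex_upper_bound:
  assumes "x \<in> Field r" and "y \<in> Field r"
  shows "\<exists>z\<in>Field r. x \<le>\<^sub>r z \<and> y \<le>\<^sub>r z"
  using total[OF assms] refl[OF assms(1)] refl[OF assms(2)] assms by blast

lemma infinite_Field: "infinite (Field r)"
  using uncountable Card_order infinite_iff_natLeq_ordLeq
    ordLeq_ordIso_trans[OF ordLess_imp_ordLeq ordIso_symmetric[OF card_of_Field_ordIso]] by blast

lemma ex_greater: "x \<in> Field r \<Longrightarrow> \<exists>y. x <\<^sub>r y"
  using infinite_Card_order_limit[OF Card_order infinite_Field] by blast

text \<open>By regularity a cofinal subset of the field has cardinality \<lambda>, so a smaller one
  is not cofinal.\<close>

lemma small_bounded:
  assumes "A \<subseteq> Field r" and "|A| <o r"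
  shows "\<exists>b\<in>Field r. \<forall>a\<in>A. a <\<^sub>r b"
proof -
  have "\<not> cofinal A r"
    using assms regular not_ordLess_ordIso unfolding regularCard_def by blast
  then obtain b where b: "b \<in> Field r" "\<And>a. a \<in> A \<Longrightarrow> \<not> b <\<^sub>r a"
    unfolding cofinal_def by blast
  obtain c where c: "b <\<^sub>r c" using ex_greater b by blast
  have "a <\<^sub>r c" if "a \<in> A" for a
  proof -
    have "a \<le>\<^sub>r b" using total[of a b] b that assms(1) by blast
    then show ?thesis using c by (rule le_less_trans)
  qed
  then show ?thesis using c by (blast intro: FieldI2)
qed

lemma card_of_under:
  assumes "x \<in> Field r"
  shows "|under r x| <o r"
proof -
  obtain y where y: "x <\<^sub>r y" using ex_greater assms by blast
  then have "under r x \<subseteq> underS r y"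
    using le_less_trans by (auto simp: under_def underS_def)
  moreover have "|underS r y| <o r"
    using y by (intro card_of_underS[OF Card_order]) (blast intro: FieldI2)
  ultimately show ?thesis
    using card_of_mono1 ordLeq_ordLess_trans by blast
qed

lemma image_initial_segment_bounded:
  assumes "x \<in> Field r" and "p \<in> Field r \<rightarrow> Field r"
  shows "\<exists>b\<in>Field r. \<forall>y. y \<le>\<^sub>r x \<longrightarrow> p y <\<^sub>r b"
proof -
  have "p ` under r x \<subseteq> Field r" using assms by (auto simp: under_def Field_def)
  moreover have "|p ` under r x| <o r"
    using card_of_under[OF assms(1)] card_of_image ordLeq_ordLess_trans by blast
  ultimately show ?thesis
    using small_bounded[of "p ` under r x"] by (simp add: under_def)
qed

text \<open>Two bounded sets have a common bound. This lets unboundedness serve as bigness in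
  \<open>ultrafilter_extension\<close>.\<close>

lemma cofinal_Un: "cofinal (A \<union> B) r \<Longrightarrow> cofinal A r \<or> cofinal B r"
proof (rule ccontr)
  assume AB: "cofinal (A \<union> B) r" and "\<not> (cofinal A r \<or> cofinal B r)"
  then obtain a b where ab: "a \<in> Field r" "b \<in> Field r"
    "\<And>x. x \<in> A \<Longrightarrow> \<not> a <\<^sub>r x" "\<And>x. x \<in> B \<Longrightarrow> \<not> b <\<^sub>r x"
    unfolding cofinal_def by blast
  obtain c where c: "c \<in> Field r" "a \<le>\<^sub>r c" "b \<le>\<^sub>r c" using ex_upper_bound ab by blast
  then obtain x where x: "x \<in> A \<union> B" "c <\<^sub>r x" using AB unfolding cofinal_def by blast
  have "a <\<^sub>r x" "b <\<^sub>r x" using le_less_trans[OF c(2) x(2)] le_less_trans[OF c(3) x(2)] by auto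
  then show False using ab(3,4) x(1) by blast
qed

section \<open>Dominating families\<close>

definition eventually_dominated :: "('a \<Rightarrow> 'a) \<Rightarrow> ('a \<Rightarrow> 'a) \<Rightarrow> bool" where
  "eventually_dominated h g \<longleftrightarrow> (\<exists>b \<in> Field r. \<forall>x. b \<le>\<^sub>r x \<longrightarrow> h x \<le>\<^sub>r g x)"

text \<open>The least cardinality of such a family is the dominating number of \<lambda>. Values
  outside \<open>Field r\<close> are arbitrary; \<open>eventually_dominated\<close> does not look at
  them.\<close>

definition dominating :: "('a \<Rightarrow> 'a) set \<Rightarrow> bool" where
  "dominating K \<longleftrightarrow> K \<subseteq> Field r \<rightarrow> Field r \<and>
     (\<forall>h \<in> Field r \<rightarrow> Field r. \<exists>g \<in> K. eventually_dominated h g)"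

text \<open>Finitely many functions have a pointwise strict bound, which none of them eventually
  dominates. Infinity is what \<open>card_of_Fpow_ordLess\<close> asks of \<open>K\<close>.\<close>

lemma dominating_infinite:
  assumes "dominating K"
  shows "infinite K"
proof
  assume "finite K"
  have "\<exists>b. \<forall>g\<in>K. g x <\<^sub>r b" if x: "x \<in> Field r" for x
  proof -
    have "finite ((\<lambda>g. g x) ` K)" using \<open>finite K\<close> by simp
    then have "|(\<lambda>g. g x) ` K| <o |Field r|" using infinite_Field by (rule finite_ordLess_infinite2)
    then have "|(\<lambda>g. g x) ` K| <o r"
      using card_of_Field_ordIso[OF Card_order] ordLess_ordIso_trans by blast
    moreover have "(\<lambda>g. g x) ` K \<subseteq> Field r" using assms x by (auto simp: dominating_def)
    ultimately show ?thesis using small_bounded[of "(\<lambda>g. g x) ` K"] by auto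
  qed
  then obtain h where h: "\<And>x g. x \<in> Field r \<Longrightarrow> g \<in> K \<Longrightarrow> g x <\<^sub>r h x" by metis
  have "id \<in> Field r \<rightarrow> Field r" by simp
  then have "K \<noteq> {}" using assms unfolding dominating_def by blast
  then have "h \<in> Field r \<rightarrow> Field r" using h by (auto intro: FieldI2)
  then obtain g b where "g \<in> K" "b \<in> Field r" "\<And>x. b \<le>\<^sub>r x \<Longrightarrow> h x \<le>\<^sub>r g x"
    using assms unfolding dominating_def eventually_dominated_def by blast
  then show False using h[of b g] refl less_not_le by blast
qed

section \<open>Clubs\<close>

text \<open>Unboundedness: starting from \<open>a\<close>, iterate a function \<open>s\<close> that
  outruns \<open>h\<close> and take the supremum of the iterates. Closedness: a point below a limit
  \<open>d\<close> of closure points lies below one of them, which keeps \<open>h x\<close> below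
  \<open>d\<close>.\<close>

lemma club_closure_points:
  assumes h: "h \<in> Field r \<rightarrow> Field r"
  shows "club r {c \<in> Field r. \<forall>x. x <\<^sub>r c \<longrightarrow> h x <\<^sub>r c}"
    (is "club r ?C")
  unfolding club_def
proof (intro conjI)
  show "cofinal ?C r"
    unfolding cofinal_def
  proof
    fix a assume a: "a \<in> Field r"
    have "\<exists>b. x \<in> Field r \<longrightarrow> b \<in> Field r \<and> x <\<^sub>r b \<and> (\<forall>y. y \<le>\<^sub>r x \<longrightarrow> h y <\<^sub>r b)" for x
    proof (cases "x \<in> Field r")
      case True
      obtain b where b: "\<And>y. y \<le>\<^sub>r x \<Longrightarrow> h y <\<^sub>r b" "b \<in> Field r"
        using image_initial_segment_bounded[OF True h] by blast
      obtain c where c: "b \<le>\<^sub>r c" "x \<le>\<^sub>r c" "c \<in> Field r"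
        using ex_upper_bound[OF b(2) True] by blast
      obtain d where d: "c <\<^sub>r d" using ex_greater[OF c(3)] by blast
      have "x <\<^sub>r d" using c(2) d by (rule le_less_trans)
      moreover have "h y <\<^sub>r d" if "y \<le>\<^sub>r x" for y
        using less_le_trans[OF b(1)[OF that] c(1)] d less_le_trans[of "h y" c d] by blast
      ultimately show ?thesis by (blast intro: FieldI2)
    qed simp
    then obtain s where s: "\<And>x. x \<in> Field r \<Longrightarrow> s x \<in> Field r"
      "\<And>x. x \<in> Field r \<Longrightarrow> x <\<^sub>r s x" "\<And>x y. x \<in> Field r \<Longrightarrow> y \<le>\<^sub>r x \<Longrightarrow> h y <\<^sub>r s x"
      by metis
    define u where "u n = (s ^^ n) a" for n
    have u: "u n \<in> Field r" for n by (induction n) (auto simp: u_def a s)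
    have u_Suc: "u (Suc n) = s (u n)" for n by (simp add: u_def)
    \<comment> \<open>Countably many iterates are bounded, since \<lambda> is regular and
      uncountable.\<close>
    have "|range u| \<le>o natLeq"
      using card_of_image[of u UNIV] card_of_nat ordLeq_ordIso_trans by blast
    then have "|range u| <o r" using uncountable ordLeq_ordLess_trans by blast
    then obtain b where b: "\<And>n. u n <\<^sub>r b" "b \<in> Field r"
      using small_bounded[of "range u"] u by (auto simp: image_subset_iff)
    \<comment> \<open>The least element of \<open>B\<close> is the supremum of the iterates: any
      \<open>x\<close> below it is at most some \<open>u n\<close>, so \<open>h x\<close> lies below
      \<open>u (Suc n)\<close>.\<close>
    define B where "B = {x \<in> Field r. \<forall>n. u n <\<^sub>r x}"
    have B: "B \<subseteq> Field r" "B \<noteq> {}" using b by (auto simp: B_def)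
    define c where "c = wo_rel.minim r B"
    have c: "c \<in> B" "\<And>x. x \<in> B \<Longrightarrow> c \<le>\<^sub>r x"
      using wo_rel.minim_in[OF wo_rel B] wo_rel.minim_least[OF wo_rel B(1)] by (auto simp: c_def)
    have "h x <\<^sub>r c" if "x <\<^sub>r c" for x
    proof -
      have "x \<in> Field r" using that by (blast intro: FieldI1)
      moreover have "x \<notin> B" using c(2)[of x] less_not_le[OF that] by blast
      ultimately obtain n where "\<not> u n <\<^sub>r x" unfolding B_def by blast
      then have "x \<le>\<^sub>r u n" using total[OF \<open>x \<in> Field r\<close> u] by blast
      then have "h x <\<^sub>r u (Suc n)" using s(3)[OF u] u_Suc by simp
      moreover have "u (Suc n) \<le>\<^sub>r c" using c(1) unfolding B_def by blast
      ultimately show ?thesis by (rule less_le_trans)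
    qed
    moreover have "a <\<^sub>r c" "c \<in> Field r" using c(1) by (auto simp: B_def u_def dest: spec[of _ 0])
    ultimately show "\<exists>c\<in>?C. a <\<^sub>r c" by blast
  qed
  show "closed_in_order r ?C"
    unfolding closed_in_order_def
  proof (intro ballI impI)
    fix d assume d: "d \<in> Field r"
      and "underS r d \<noteq> {} \<and> cofinal (?C \<inter> underS r d) (Restr r (underS r d))"
    then have cof: "cofinal (?C \<inter> underS r d) (Restr r (underS r d))" by blast
    have "h x <\<^sub>r d" if x: "x <\<^sub>r d" for x
    proof -
      have "x \<in> Field (Restr r (underS r d))"
        using x refl[of x] by (auto simp: Field_def underS_def)
      then obtain c where "c \<in> ?C" "c <\<^sub>r d" "x <\<^sub>r c"
        using cof unfolding cofinal_def underS_def by blast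
      then have "h x <\<^sub>r c" "c \<le>\<^sub>r d" by blast+
      then show ?thesis by (rule less_le_trans)
    qed
    then show "d \<in> ?C" using d by blast
  qed
qed auto

text \<open>Eventual domination holds only from some \<open>b\<close> on, so a club has to be cut
  off there.\<close>

lemma club_tail:
  assumes C: "club r C" and b: "b \<in> Field r"
  shows "club r {c \<in> C. b \<le>\<^sub>r c}"
  unfolding club_def
proof (intro conjI)
  show "{c \<in> C. b \<le>\<^sub>r c} \<subseteq> Field r" using C by (auto simp: club_def)
  show "cofinal {c \<in> C. b \<le>\<^sub>r c} r"
    unfolding cofinal_def
  proof
    fix a assume a: "a \<in> Field r"
    obtain m where m: "m \<in> Field r" "a \<le>\<^sub>r m" "b \<le>\<^sub>r m" using ex_upper_bound a b by blast
    then obtain c where c: "c \<in> C" "m <\<^sub>r c" using C unfolding club_def cofinal_def by blast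
    have "a <\<^sub>r c" "b <\<^sub>r c" using le_less_trans[OF m(2) c(2)] le_less_trans[OF m(3) c(2)] by auto
    then show "\<exists>c\<in>{c \<in> C. b \<le>\<^sub>r c}. a <\<^sub>r c" using c(1) by blast
  qed
  show "closed_in_order r {c \<in> C. b \<le>\<^sub>r c}"
    unfolding closed_in_order_def
  proof (intro ballI impI)
    fix d assume d: "d \<in> Field r"
      and *: "underS r d \<noteq> {} \<and>
        cofinal ({c \<in> C. b \<le>\<^sub>r c} \<inter> underS r d) (Restr r (underS r d))"
    then have "cofinal (C \<inter> underS r d) (Restr r (underS r d))"
      unfolding cofinal_def by blast
    then have "d \<in> C" using C d * by (auto simp: club_def closed_in_order_def)
    \<comment> \<open>Nonemptiness supplies a point below \<open>d\<close>; cofinality then supplies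
      a member of the tail below \<open>d\<close>, so \<open>b\<close> lies below
      \<open>d\<close>.\<close>
    obtain x where x: "x <\<^sub>r d" using * by (auto simp: underS_def)
    then have "x \<in> Field (Restr r (underS r d))"
      using refl[of x] by (auto simp: Field_def underS_def)
    then obtain c where "b \<le>\<^sub>r c" "c <\<^sub>r d"
      using * unfolding cofinal_def underS_def by blast
    then show "d \<in> {c \<in> C. b \<le>\<^sub>r c}" using \<open>d \<in> C\<close> trans[of b c d] by blast
  qed
qed

section \<open>One stage of the recursion\<close>

text \<open>Here \<open>p d\<close> is the end point of the interval, not its length.\<close>

definition escape :: "('a \<Rightarrow> 'a) \<Rightarrow> 'a set \<Rightarrow> 'a set" where
  "escape p C = Field r - (\<Union>d\<in>C. ord_interval r d (p d))"

text \<open>The hypothesis \<open>few\<close> puts the size of \<open>\<G>\<close> below the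
  dominating number, so the functions \<open>g A\<close> do not form a dominating family, and the
  \<open>h\<close> they miss defines the club.\<close>

lemma club_escaping_few_sets:
  assumes few: "\<And>K. dominating K \<Longrightarrow> |\<G>| <o |K|"
    and cof: "\<And>A. A \<in> \<G> \<Longrightarrow> A \<subseteq> Field r \<and> cofinal A r"
    and p: "p \<in> Field r \<rightarrow> Field r"
  shows "\<exists>C. club r C \<and> (\<forall>A\<in>\<G>. cofinal (A \<inter> escape p C) r)"
proof -
  have "\<exists>y. A \<in> \<G> \<and> x \<in> Field r \<longrightarrow> y \<in> A \<and> x <\<^sub>r y \<and> (\<forall>d. d \<le>\<^sub>r x \<longrightarrow> p d <\<^sub>r y)" for A x
  proof (cases "A \<in> \<G> \<and> x \<in> Field r")
    case True
    then obtain b where b: "\<And>d. d \<le>\<^sub>r x \<Longrightarrow> p d <\<^sub>r b" "b \<in> Field r"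
      using image_initial_segment_bounded p by blast
    obtain m where m: "m \<in> Field r" "x \<le>\<^sub>r m" "b \<le>\<^sub>r m"
      using ex_upper_bound True b by blast
    obtain y where y: "y \<in> A" "m <\<^sub>r y"
      using cof True m(1) unfolding cofinal_def by blast
    have xy: "x <\<^sub>r y" and b_y: "b <\<^sub>r y"
      using le_less_trans[OF m(2) y(2)] le_less_trans[OF m(3) y(2)] by auto
    have "p d <\<^sub>r y" if "d \<le>\<^sub>r x" for d
      using b(1)[OF that] b_y less_le_trans[of "p d" b y] by blast
    with y xy show ?thesis by blast
  qed auto
  then obtain g where g: "\<And>A x. A \<in> \<G> \<Longrightarrow> x \<in> Field r \<Longrightarrow> g A x \<in> A"
    "\<And>A x. A \<in> \<G> \<Longrightarrow> x \<in> Field r \<Longrightarrow> x <\<^sub>r g A x"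
    "\<And>A x d. A \<in> \<G> \<Longrightarrow> x \<in> Field r \<Longrightarrow> d \<le>\<^sub>r x \<Longrightarrow> p d <\<^sub>r g A x"
    by metis
  have "\<not> dominating (g ` \<G>)"
    using few card_of_image not_ordLess_ordLeq by blast
  moreover have "g ` \<G> \<subseteq> Field r \<rightarrow> Field r" using g(1) cof by blast
  ultimately have "\<exists>h\<in>Field r \<rightarrow> Field r. \<forall>A\<in>\<G>. \<not> eventually_dominated h (g A)"
    by (simp add: dominating_def)
  then obtain h where h: "h \<in> Field r \<rightarrow> Field r"
    and hg: "\<And>A. A \<in> \<G> \<Longrightarrow> \<not> eventually_dominated h (g A)"
    by blast
  define C where "C = {c \<in> Field r. \<forall>x. x <\<^sub>r c \<longrightarrow> h x <\<^sub>r c}"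
  have "cofinal (A \<inter> escape p C) r" if A: "A \<in> \<G>" for A
    unfolding cofinal_def
  proof
    fix b assume b: "b \<in> Field r"
    \<comment> \<open>Non-domination gives such \<open>x\<close> above any \<open>b\<close>; the
      point that escapes is \<open>g A x\<close>, not \<open>x\<close>.\<close>
    obtain x where x: "b \<le>\<^sub>r x" "\<not> h x \<le>\<^sub>r g A x"
      using hg[OF A] b unfolding eventually_dominated_def by blast
    then have xF: "x \<in> Field r" by (blast intro: FieldI2)
    let ?y = "g A x"
    have y: "?y \<in> A" "x <\<^sub>r ?y" "?y \<in> Field r" using g A xF cof by blast+
    then have yh: "?y <\<^sub>r h x" using x total h xF by blast
    have "?y \<notin> ord_interval r d (p d)" if d: "d \<in> C" for d
    proof
      assume "?y \<in> ord_interval r d (p d)"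
      then have dy: "d \<le>\<^sub>r ?y" "?y <\<^sub>r p d" by (auto simp: ord_interval_def underS_def)
      show False
      \<comment> \<open>If \<open>d\<close> is at most \<open>x\<close>, the interval ends before
        \<open>?y\<close>. Otherwise closure under \<open>h\<close> puts \<open>d\<close> above
        \<open>h x\<close>, hence above \<open>?y\<close>.\<close>
      proof (cases "d \<le>\<^sub>r x")
        case True
        then show False using g(3)[OF A xF True] dy(2) less_not_le by blast
      next
        case False
        then have "x <\<^sub>r d" using total xF d by (auto simp: C_def)
        then have "h x <\<^sub>r d" using d by (simp add: C_def)
        then have "h x <\<^sub>r ?y" using dy(1) by (rule less_le_trans)
        then show False using less_not_le[OF yh] by blast
      qed
    qed
    then have "?y \<in> A \<inter> escape p C" using y by (auto simp: escape_def)
    moreover have "b <\<^sub>r ?y" using x(1) y(2) by (rule le_less_trans)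
    ultimately show "\<exists>y\<in>A \<inter> escape p C. b <\<^sub>r y" by blast
  qed
  moreover have "club r C" using club_closure_points[OF h] by (simp add: C_def)
  ultimately show ?thesis by blast
qed

section \<open>Recursion along a least dominating family\<close>

lemma cofinal_Field: "cofinal (Field r) r"
  unfolding cofinal_def using ex_greater by (metis FieldI2)

lemma ex_minimal_dominating:
  obtains K where "dominating K" and "\<And>L. dominating L \<Longrightarrow> |K| \<le>o |L|"
proof -
  let ?Q = "{ |K| | K. dominating K}"
  have "eventually_dominated h h" if "h \<in> Field r \<rightarrow> Field r" for h
    using that refl infinite_Field unfolding eventually_dominated_def
    by (metis FieldI2 Pi_mem infinite_imp_nonempty ex_in_conv)
  then have "dominating (Field r \<rightarrow> Field r)" unfolding dominating_def by blast
  then have "?Q \<noteq> {}" by blast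
  then obtain R where R: "R \<in> ?Q" "\<And>R'. R' <o R \<Longrightarrow> R' \<notin> ?Q"
    using wf_ordLess unfolding wf_eq_minimal by (metis (no_types, lifting) ex_in_conv)
  then obtain K where K: "R = |K|" "dominating K" by blast
  have "|K| \<le>o |L|" if "dominating L" for L
    using R(2)[of "|L|"] K that ordLess_or_ordLeq[OF card_of_Well_order card_of_Well_order] by blast
  with K that show ?thesis by blast
qed

text \<open>In the cardinal order \<open>|K|\<close> each element has fewer than \<open>|K|\<close>
  predecessors, hence fewer than \<open>|K|\<close> finite sets of them. Minimality of
  \<open>|K|\<close> turns this into the hypothesis of
  \<open>club_escaping_few_sets\<close>.\<close>

lemma ex_centered_clubs:
  assumes K: "dominating K" and least: "\<And>L. dominating L \<Longrightarrow> |K| \<le>o |L|"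
  obtains C where "\<And>p. p \<in> K \<Longrightarrow> club r (C p)"
    and "\<And>S. finite S \<Longrightarrow> S \<subseteq> K \<Longrightarrow> cofinal (Field r \<inter> (\<Inter>p\<in>S. escape p (C p))) r"
proof -
  let ?k = "|K|"
  interpret k: wo_rel "?k" by (simp add: wo_rel_def card_of_Well_order)
  let ?I = "\<lambda>C S. Field r \<inter> (\<Inter>p\<in>S. escape p (C p))"
  \<comment> \<open>The invariant: the club \<open>c\<close> for \<open>p\<close> keeps every finite
    intersection of earlier stages unbounded. It is vacuous outside \<open>K\<close>, as the
    recursion defines \<open>C\<close> on the whole type.\<close>
  define P where "P C p c \<longleftrightarrow> (p \<in> K \<longrightarrow> club r c \<and>
      (\<forall>S. finite S \<and> S \<subseteq> underS ?k p \<longrightarrow> cofinal (?I C S \<inter> escape p c) r))"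
    for C p c
  have max: "\<exists>q\<in>S. S - {q} \<subseteq> underS ?k q" if "finite S" "S \<noteq> {}" "S \<subseteq> K" for S
    using that
  proof (induction S rule: finite_ne_induct)
    case (singleton x) then show ?case by simp
  next
    case (insert x S)
    then obtain q where q: "q \<in> S" "S - {q} \<subseteq> underS ?k q" by auto
    have qx: "q \<in> Field ?k" "x \<in> Field ?k" "q \<noteq> x" using q insert by (auto simp: Field_card_of)
    then consider "(x, q) \<in> ?k" | "(q, x) \<in> ?k" using k.TOTALS by blast
    then show ?case
    proof cases
      case 1
      then show ?thesis using q qx by (intro bexI[of _ q]) (auto simp: underS_def)
    next
      case 2
      have "y \<in> underS ?k x" if "y \<in> S" for y
        using that q qx 2 \<open>x \<notin> S\<close> k.TRANS unfolding underS_def by (auto dest: transD)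
      then show ?thesis by auto
    qed
  qed
  \<comment> \<open>The invariant at the last index \<open>q\<close> of \<open>S\<close> already
    speaks of the whole intersection.\<close>
  have step: "cofinal (?I C S) r"
    if P: "\<And>p. p \<in> S \<Longrightarrow> P C p (C p)" and S: "finite S" "S \<subseteq> K" for C S
  proof (cases "S = {}")
    case True then show ?thesis by (simp add: cofinal_Field)
  next
    case False
    then obtain q where q: "q \<in> S" "S - {q} \<subseteq> underS ?k q" using max S by blast
    then have "cofinal (?I C (S - {q}) \<inter> escape q (C q)) r"
      using P[of q] S unfolding P_def by blast
    moreover have "?I C (S - {q}) \<inter> escape q (C q) = ?I C S" using q by auto
    ultimately show ?thesis by simp
  qed
  have "\<exists>C. \<forall>p. P C p (C p)"
  proof (rule dependent_wf_choice[of "?k - Id"])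
    show "wf (?k - Id)" by (rule k.WF)
    \<comment> \<open>The invariant reads \<open>C\<close> only strictly below \<open>p\<close>, so
      the recursion is well founded.\<close>
    show "P f p c = P g p c" if "\<And>q. (q, p) \<in> ?k - Id \<Longrightarrow> f q = g q" for f g p c
    proof -
      have "?I f S = ?I g S" if "S \<subseteq> underS ?k p" for S
      proof -
        have "f q = g q" if "q \<in> S" for q
          using that \<open>S \<subseteq> underS ?k p\<close> \<open>\<And>q. (q, p) \<in> ?k - Id \<Longrightarrow> f q = g q\<close>
          by (auto simp: underS_def)
        then show ?thesis by simp
      qed
      then show ?thesis unfolding P_def by (metis (no_types, lifting))
    qed
    show "\<exists>c. P C p c" if IH: "\<And>q. (q, p) \<in> ?k - Id \<Longrightarrow> P C q (C q)" for p C
    proof (cases "p \<in> K")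
      case p: True
      \<comment> \<open>\<open>Fpow\<close> contains the empty set, so \<open>Field r\<close> itself
        is among the sets kept unbounded.\<close>
      let ?G = "?I C ` Fpow (underS ?k p)"
      have U: "underS ?k p \<subseteq> K" using Field_card_of[of K] by (auto simp: underS_def Field_def)
      have "|underS ?k p| <o ?k"
        using card_of_underS[of ?k p] p by (simp add: Field_card_of card_of_Card_order)
      then have "|Fpow (underS ?k p)| <o ?k"
        using dominating_infinite[OF K] by (rule card_of_Fpow_ordLess)
      then have "|?G| <o ?k" using card_of_image ordLeq_ordLess_trans by blast
      then have few: "|?G| <o |L|" if "dominating L" for L
        using least[OF that] ordLess_ordLeq_trans by blast
      have "A \<subseteq> Field r \<and> cofinal A r" if A: "A \<in> ?G" for A
      proof -
        from A obtain S where S: "A = ?I C S" "finite S" "S \<subseteq> underS ?k p"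
          unfolding Fpow_def by blast
        have "cofinal (?I C S) r"
          using S U IH by (intro step) (auto simp: underS_def)
        with S show ?thesis by simp
      qed
      moreover have "p \<in> Field r \<rightarrow> Field r" using K p by (auto simp: dominating_def)
      ultimately obtain c where "club r c" "\<forall>A\<in>?G. cofinal (A \<inter> escape p c) r"
        using club_escaping_few_sets few by (metis (no_types, lifting))
      then have "P C p c" unfolding P_def Fpow_def by blast
      then show ?thesis ..
    qed (simp add: P_def)
  qed
  then obtain C where C: "\<And>p. P C p (C p)" by blast
  show ?thesis
  proof (rule that)
    show "club r (C p)" if "p \<in> K" for p using C[of p] that by (simp add: P_def)
    show "cofinal (?I C S) r" if "finite S" "S \<subseteq> K" for S using step C that by blast
  qed
qed

section \<open>The ultrafilter\<close>

text \<open>For each \<open>f\<close> some \<open>g\<close> in \<open>K\<close> eventually bounds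
  the end points, and a tail of \<open>C g\<close> is the club wanted: what it covers is disjoint
  from \<open>escape g (C g)\<close>, a member of \<open>D\<close>.\<close>

lemma ex_weakly_reasonable: "\<exists>D. weakly_reasonable r D"
proof -
  obtain K where K: "dominating K" "\<And>L. dominating L \<Longrightarrow> |K| \<le>o |L|"
    using ex_minimal_dominating by blast
  obtain C where C: "\<And>p. p \<in> K \<Longrightarrow> club r (C p)"
    and fip: "\<And>S. finite S \<Longrightarrow> S \<subseteq> K \<Longrightarrow> cofinal (Field r \<inter> (\<Inter>p\<in>S. escape p (C p))) r"
    using ex_centered_clubs[OF K] by blast
  have "\<exists>D. ultrafilter_on (Field r) D \<and> (\<lambda>p. escape p (C p)) ` K \<subseteq> D \<and>
          (\<forall>A\<in>D. cofinal A r)"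
  proof (rule ultrafilter_extension)
    show "cofinal B r" if "cofinal A r" "A \<subseteq> B" for A B
      using that unfolding cofinal_def by blast
    show "\<not> cofinal {} r" using infinite_Field by (auto simp: cofinal_def)
    show "(\<lambda>p. escape p (C p)) ` K \<subseteq> Pow (Field r)" by (auto simp: escape_def)
    show "cofinal (Field r \<inter> \<Inter>S) r" if "finite S" "S \<subseteq> (\<lambda>p. escape p (C p)) ` K" for S
      using finite_subset_image[OF that] fip by auto
  qed (rule cofinal_Un)
  then obtain D where D: "ultrafilter_on (Field r) D"
    "(\<lambda>p. escape p (C p)) ` K \<subseteq> D" "\<forall>A\<in>D. cofinal A r" by (elim exE conjE)
  \<comment> \<open>Uniformity: by regularity an unbounded subset of the field has cardinality
    \<lambda>.\<close>
  have "|A| =o r" if "A \<in> D" for A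
  proof -
    have "D \<subseteq> Pow (Field r)" using D(1) by (simp add: ultrafilter_on_def)
    then have "A \<subseteq> Field r" using that by blast
    then show ?thesis using D(3) that regular unfolding regularCard_def by simp
  qed
  then have unif: "uniform_ultrafilter r D" using D(1) by (simp add: uniform_ultrafilter_def)
  have "\<exists>E. club r E \<and> (\<Union>d \<in> E. ord_interval r d (ord_plus r d (f d))) \<notin> D" for f
  proof -
    let ?q = "\<lambda>d. ord_plus r d (f d)"
    \<comment> \<open>If \<open>ord_plus\<close> takes a junk value outside \<open>Field r\<close>, the interval is empty.\<close>
    define p where "p d = (if ?q d \<in> Field r then ?q d else d)" for d
    have "p \<in> Field r \<rightarrow> Field r" by (auto simp: p_def)
    then obtain g b where g: "g \<in> K" and b: "b \<in> Field r" "\<And>x. b \<le>\<^sub>r x \<Longrightarrow> p x \<le>\<^sub>r g x"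
      using K(1) unfolding dominating_def eventually_dominated_def by blast
    let ?E = "{c \<in> C g. b \<le>\<^sub>r c}"
    let ?U = "\<Union>d \<in> ?E. ord_interval r d (?q d)"
    have "ord_interval r d (?q d) \<subseteq> ord_interval r d (g d)" if "b \<le>\<^sub>r d" for d
    proof
      fix x assume "x \<in> ord_interval r d (?q d)"
      then have x: "d \<le>\<^sub>r x" "x <\<^sub>r ?q d" by (auto simp: ord_interval_def underS_def)
      then have "p d = ?q d" by (auto simp: p_def intro: FieldI2)
      then have "x <\<^sub>r g d" using b(2)[OF that] x(2) less_le_trans[of x "p d" "g d"] by metis
      then show "x \<in> ord_interval r d (g d)" using x by (simp add: ord_interval_def underS_def)
    qed
    then have disj: "?U \<inter> escape g (C g) = {}" by (auto simp: escape_def)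
    have "?U \<notin> D"
    proof -
      have "escape g (C g) \<in> D" using g D(2) by blast
      moreover have "{} \<notin> D" "\<forall>A\<in>D. \<forall>B\<in>D. A \<inter> B \<in> D"
        using D(1) by (simp_all add: ultrafilter_on_def)
      ultimately show ?thesis using disj by metis
    qed
    then show ?thesis using club_tail[OF C[OF g] b(1)] by blast
  qed
  then have "weakly_reasonable r D" using unif by (simp add: weakly_reasonable_def)
  then show ?thesis ..
qed

end

theorem theorem2p9:
  fixes r :: "'a rel"
  assumes "Card_order r" and "regularCard r" and "natLeq <o r"
  shows "\<exists>D. uniform_ultrafilter r D \<and> weakly_reasonable r D"
proof -
  interpret regular_uncountable r using assms by unfold_locales
  show ?thesis using ex_weakly_reasonable by (auto simp: weakly_reasonable_def)
qed

end
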